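(* Let $T=(t_{ij})$ be an $n\times n$ real matrix that satisfies the following: (1) $\sum_{i=1}^n t_{ij}>0$ for $j=1,\dots,n$; (2) $T^k$ is an irreducible nonnegative matrix for some positive integer $k$. Then the spectral radius $\rho(T)$ itself is an eigenvalue of $T$ with multiplicity one.
   Context: The spectral radius of a square real matrix $M$ is $\rho(M)=\max\{|\lambda| : \lambda\in\mathbb{C}\text{ is an eigenvalue of }M\}$. A matrix $M$ is reducible if there is a permutation matrix $P$ such that $P^tMP=\begin{pmatrix}A&B\\0&D\end{pmatrix}$ with $A,D$ (nonempty) square submatrices; it is irreducible if it is not reducible. Nonnegative means all entries are $\ge0$. Multiplicity means algebraic multiplicity. *)

theory Defs
  imports "Jordan_Normal_Form.Spectral_Radius"
begin

definition permutation_mat :: "nat \<Rightarrow> 'a :: semiring_1 mat \<Rightarrow> bool" where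
  "permutation_mat n P \<longleftrightarrow>
     (\<exists>p. p permutes {0..<n} \<and> P = mat n n (\<lambda>(i, j). if i = p j then 1 else 0))"

definition reducible_mat :: "'a :: semiring_1 mat \<Rightarrow> bool" where
  "reducible_mat M \<longleftrightarrow>
     (\<exists>r s P A B D. 0 < r \<and> 0 < s \<and> M \<in> carrier_mat (r + s) (r + s) \<and>
        permutation_mat (r + s) P \<and>
        A \<in> carrier_mat r r \<and> B \<in> carrier_mat r s \<and> D \<in> carrier_mat s s \<and>
        transpose_mat P * M * P = four_block_mat A B (0\<^sub>m s r) D)"

text \<open>Every \<open>1 \<times> 1\<close> matrix is irreducible in this sense, including the zero matrix.\<close>

definition irreducible_mat :: "'a :: semiring_1 mat \<Rightarrow> bool" where
  "irreducible_mat M \<longleftrightarrow> square_mat M \<and> \<not> reducible_mat M"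

definition nonneg_mat :: "'a :: {zero, ord} mat \<Rightarrow> bool" where
  "nonneg_mat M \<longleftrightarrow> (\<forall>i < dim_row M. \<forall>j < dim_col M. 0 \<le> M $$ (i, j))"

text \<open>The library's \<^const>\<open>spectral_radius\<close> lives on complex matrices, so a real matrix is
  embedded first.\<close>

definition real_spectral_radius :: "real mat \<Rightarrow> real" where
  "real_spectral_radius M = spectral_radius (map_mat complex_of_real M)"

end

theory Submission
  imports Defs
begin

text \<open>Put \<open>A = T ^\<^sub>m k\<close>, an irreducible nonnegative matrix. Perron--Frobenius theory provides
  positive eigenvectors \<open>v\<close> of \<open>A\<close> and \<open>w\<close> of its transpose, both for the spectral radius
  \<open>r\<close> of \<open>A\<close> (lemma \<open>perron_vector_exists\<close>), and shows that the eigenspace of \<open>A\<close> for \<open>r\<close> is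
  spanned by \<open>v\<close> (lemma \<open>eigenspace_of_positive_vector\<close>).

  As \<open>T\<close> commutes with \<open>A\<close>, it maps this line to itself, so \<open>T v = \<mu> v\<close> for a real \<open>\<mu>\<close> with
  \<open>\<mu> ^ k = r\<close>. Summing the entries of \<open>T v = \<mu> v\<close> gives
  \<open>\<mu> (\<Sum>i. v\<^sub>i) = \<Sum>j. (\<Sum>i. t\<^sub>i\<^sub>j) v\<^sub>j > 0\<close>: positivity of the column sums is what makes
  \<open>\<mu>\<close> the positive \<open>k\<close>-th root of \<open>r\<close>. For each eigenvalue \<open>\<lambda>\<close> of \<open>T\<close>, the power \<open>\<lambda> ^ k\<close> is an eigenvalue of \<open>A\<close>, whence
  \<open>\<bar>\<lambda>\<bar> ^ k \<le> r = \<mu> ^ k\<close>. Therefore \<open>\<mu>\<close> is the spectral radius of \<open>T\<close>.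

  The eigenvalue \<open>\<mu>\<close> is simple for two reasons. Its eigenspace is the line through \<open>v\<close>,
  because \<open>T x = \<mu> x\<close> implies \<open>A x = r x\<close>. And this line carries no longer Jordan chain:
  \<open>w\<close> is a left eigenvector of \<open>T\<close> for \<open>\<mu>\<close> as well, so pairing \<open>T u - \<mu> u = c v\<close> with
  \<open>w\<close> yields \<open>0 = c (w \<bullet> v)\<close>, while \<open>w \<bullet> v > 0\<close>. Lemma \<open>order_char_poly_eq_1\<close> turns these two
  facts into a statement about the characteristic polynomial without Jordan forms.

  The Perron vector itself is the vector of absolute values of a complex eigenvector for an
  eigenvalue of maximal modulus. It satisfies \<open>A y \<ge> r y\<close>; were this not an equality, applying
  the positive matrix \<open>(1 + A)\<^sup>n\<close> would produce a vector that \<open>A\<close> stretches by more than \<open>r\<close>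
  in every coordinate, and then powers of \<open>A\<close> would grow faster than \<open>r\<close> permits.\<close>

section \<open>Entrywise products\<close>

lemma mult_mat_vec_sum:
  assumes "A \<in> carrier_mat n n" "v \<in> carrier_vec n" "i < n"
  shows "(A *\<^sub>v v) $ i = (\<Sum>j<n. A $$ (i, j) * v $ j)"
  using assms by (auto simp: scalar_prod_def atLeast0LessThan intro!: sum.cong)

lemma mult_mat_sum:
  assumes "A \<in> carrier_mat n n" "B \<in> carrier_mat n n" "i < n" "j < n"
  shows "(A * B) $$ (i, j) = (\<Sum>l\<in>{0..<n}. A $$ (i, l) * B $$ (l, j))"
  using assms by (auto simp: scalar_prod_def intro!: sum.cong)

section \<open>Irreducibility as strong connectedness\<close>

text \<open>Irreducibility in terms of the digraph with an edge from \<open>j\<close> to \<open>i\<close> whenever the entry at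
  \<open>(i, j)\<close> is nonzero: every proper nonempty set of vertices has an edge leaving it. Unlike
  the definition by permutation matrices, this form is used directly in arguments about
  supports of vectors.\<close>

definition strongly_connected_mat :: "nat \<Rightarrow> 'a :: zero mat \<Rightarrow> bool" where
  "strongly_connected_mat n A \<longleftrightarrow>
     (\<forall>S. S \<noteq> {} \<and> S \<subset> {..<n} \<longrightarrow> (\<exists>i \<in> {..<n} - S. \<exists>j \<in> S. A $$ (i, j) \<noteq> 0))"

lemma ex_permutation_initial_segment:
  assumes "S \<subseteq> {..<n}"
  obtains p where "p permutes {0..<n}" "p ` {0..<card S} = S"
proof -
  have fin: "finite S" using assms finite_subset by blast
  have le: "card S \<le> n" using card_mono[OF _ assms] by simp
  obtain f where f: "bij_betw f {0..<card S} S" using ex_bij_betw_nat_finite[OF fin] by blast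
  have "card ({..<n} - S) = card {card S..<n}" using assms fin by (simp add: card_Diff_subset)
  then obtain g where g: "bij_betw g {card S..<n} ({..<n} - S)"
    using finite_same_card_bij[of "{card S..<n}" "{..<n} - S"] by auto
  define p where "p i = (if i < card S then f i else if i < n then g i else i)" for i
  have 1: "bij_betw p {0..<card S} S" using f by (subst bij_betw_cong[of _ _ f]) (auto simp: p_def)
  have 2: "bij_betw p {card S..<n} ({..<n} - S)"
    using g by (subst bij_betw_cong[of _ _ g]) (auto simp: p_def)
  have "bij_betw p ({0..<card S} \<union> {card S..<n}) (S \<union> ({..<n} - S))"
    by (rule bij_betw_combine[OF 1 2]) auto
  moreover have "{0..<card S} \<union> {card S..<n} = {0..<n}" "S \<union> ({..<n} - S) = {0..<n}"
    using le assms by auto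
  ultimately have "bij_betw p {0..<n} {0..<n}" by (simp only:)
  then have "p permutes {0..<n}"
    by (rule bij_imp_permutes) (use le in \<open>auto simp: p_def\<close>)
  then show thesis using that 1 by (auto simp: bij_betw_def)
qed

text \<open>If no edge leaves \<open>S\<close>, then numbering the elements of \<open>S\<close> first puts a zero block in the
  lower left corner.\<close>

lemma irreducible_imp_strongly_connected:
  fixes A :: "'a :: semiring_1 mat"
  assumes A: "A \<in> carrier_mat n n" and irr: "irreducible_mat A"
  shows "strongly_connected_mat n A"
  unfolding strongly_connected_mat_def
proof (intro allI impI, rule ccontr)
  fix S assume S: "S \<noteq> {} \<and> S \<subset> {..<n}"
    and no: "\<not> (\<exists>i \<in> {..<n} - S. \<exists>j \<in> S. A $$ (i, j) \<noteq> 0)"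
  define r where "r = card S"
  have fin: "finite S" using S finite_subset[of S "{..<n}"] by auto
  have r0: "0 < r" using S fin by (auto simp: r_def card_gt_0_iff)
  have rn: "r < n" using psubset_card_mono[of "{..<n}" S] S by (simp add: r_def)
  obtain p where p: "p permutes {0..<n}" and pS: "p ` {0..<r} = S"
    using ex_permutation_initial_segment[of S n] S unfolding r_def by blast
  have pn: "p i < n" if "i < n" for i using permutes_in_image[OF p, of i] that by simp
  define P :: "'a mat" where "P = mat n n (\<lambda>(i, j). if i = p j then 1 else 0)"
  have P: "P \<in> carrier_mat n n" by (simp add: P_def)
  define M where "M = transpose_mat P * A * P"
  have M: "M \<in> carrier_mat n n" using A P by (simp add: M_def)
  have PA: "(transpose_mat P * A) $$ (i, j) = A $$ (p i, j)" if "i < n" "j < n" for i j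
  proof -
    have "(transpose_mat P * A) $$ (i, j) = (\<Sum>l\<in>{0..<n}. P $$ (l, i) * A $$ (l, j))"
      using that A P by (subst mult_mat_sum[of _ n]) auto
    also have "\<dots> = (\<Sum>l\<in>{0..<n}. if l = p i then A $$ (l, j) else 0)"
      using that by (intro sum.cong) (auto simp: P_def)
    also have "\<dots> = A $$ (p i, j)" using pn[OF that(1)] by simp
    finally show ?thesis .
  qed
  have Mij: "M $$ (i, j) = A $$ (p i, p j)" if "i < n" "j < n" for i j
  proof -
    have "M $$ (i, j) = (\<Sum>l\<in>{0..<n}. (transpose_mat P * A) $$ (i, l) * P $$ (l, j))"
      unfolding M_def using that A P by (intro mult_mat_sum[of _ n]) auto
    also have "\<dots> = (\<Sum>l\<in>{0..<n}. if l = p j then A $$ (p i, l) else 0)"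
      using that PA by (intro sum.cong) (auto simp: P_def)
    also have "\<dots> = A $$ (p i, p j)" using pn[OF that(2)] by simp
    finally show ?thesis .
  qed
  obtain M1 M2 M3 M4 where sp: "split_block M r r = (M1, M2, M3, M4)"
    by (cases "split_block M r r")
  have d: "dim_row M = r + (n - r)" "dim_col M = r + (n - r)" using M rn by auto
  note sb = split_block[OF sp d]
  have "M3 = 0\<^sub>m (n - r) r"
  proof (rule eq_matI)
    fix i j assume ij: "i < dim_row (0\<^sub>m (n - r) r :: 'a mat)" "j < dim_col (0\<^sub>m (n - r) r :: 'a mat)"
    then have ij': "i < n - r" "j < r" by auto
    have "M3 $$ (i, j) = M $$ (i + r, j)"
      using sp ij' d by (auto simp: split_block_def Let_def)
    also have "\<dots> = A $$ (p (i + r), p j)" using ij' rn by (intro Mij) auto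
    also have "\<dots> = 0"
    proof -
      have "p j \<in> S" using pS ij' by auto
      moreover have "p (i + r) \<notin> S"
        unfolding pS[symmetric] inj_image_mem_iff[OF permutes_inj[OF p]] by simp
      moreover have "p (i + r) < n" using pn ij' by simp
      ultimately show ?thesis using no by auto
    qed
    finally show "M3 $$ (i, j) = 0\<^sub>m (n - r) r $$ (i, j)" using ij' by simp
  qed (use sb in auto)
  then have block: "transpose_mat P * A * P = four_block_mat M1 M2 (0\<^sub>m (n - r) r) M4"
    using sb(5) unfolding M_def by (simp only:)
  have "r + (n - r) = n" using rn by simp
  moreover have "permutation_mat n P" using p unfolding permutation_mat_def P_def by blast
  ultimately have "A \<in> carrier_mat (r + (n - r)) (r + (n - r))" "permutation_mat (r + (n - r)) P"
    using A by (simp_all only:)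
  moreover have "0 < n - r" using rn by simp
  ultimately have "reducible_mat A"
    using block sb(1,2,4) r0 unfolding reducible_mat_def by blast
  then show False using irr by (simp add: irreducible_mat_def)
qed

text \<open>An edge leaving the complement of \<open>S\<close> is, reversed, an edge leaving \<open>S\<close>.\<close>

lemma strongly_connected_transpose:
  assumes "A \<in> carrier_mat n n" "strongly_connected_mat n A"
  shows "strongly_connected_mat n (transpose_mat A)"
  unfolding strongly_connected_mat_def
proof (intro allI impI)
  fix S assume S: "S \<noteq> {} \<and> S \<subset> {..<n}"
  then have "{..<n} - S \<noteq> {} \<and> {..<n} - S \<subset> {..<n}" by auto
  then obtain i j where "i \<in> {..<n} - ({..<n} - S)" "j \<in> {..<n} - S" "A $$ (i, j) \<noteq> 0"
    using assms(2) unfolding strongly_connected_mat_def by meson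
  then show "\<exists>i \<in> {..<n} - S. \<exists>j \<in> S. transpose_mat A $$ (i, j) \<noteq> 0"
    using assms(1) by (intro bexI[of _ j] bexI[of _ i]) auto
qed

section \<open>Supports of nonnegative vectors\<close>

lemma mult_mat_vec_nonneg:
  fixes A :: "real mat"
  assumes "A \<in> carrier_mat n n" "nonneg_mat A" "y \<in> carrier_vec n" "\<forall>i<n. 0 \<le> y $ i" "i < n"
  shows "0 \<le> (A *\<^sub>v y) $ i"
  using assms by (subst mult_mat_vec_sum) (auto simp: nonneg_mat_def intro!: sum_nonneg)

text \<open>An edge that leaves the support of \<open>y\<close> carries a positive contribution to a coordinate
  where \<open>y\<close> vanishes, and nonnegativity rules out cancellation.\<close>

lemma strongly_connected_support_grows:
  fixes A :: "real mat"
  assumes A: "A \<in> carrier_mat n n" and nn: "nonneg_mat A" and sc: "strongly_connected_mat n A"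
    and y: "y \<in> carrier_vec n" "\<forall>i<n. 0 \<le> y $ i" "y \<noteq> 0\<^sub>v n"
    and z: "\<exists>i<n. y $ i = 0"
  shows "\<exists>i<n. y $ i = 0 \<and> 0 < (A *\<^sub>v y) $ i"
proof -
  let ?S = "{i. i < n \<and> y $ i \<noteq> 0}"
  have "?S \<noteq> {}" using y(1,3) by (auto intro!: eq_vecI)
  moreover have "?S \<subset> {..<n}" using z by auto
  ultimately obtain i j where ij: "i \<in> {..<n} - ?S" "j \<in> ?S" "A $$ (i, j) \<noteq> 0"
    using sc unfolding strongly_connected_mat_def by meson
  have ij': "i < n" "j < n" using ij by auto
  have "0 < A $$ (i, j) * y $ j"
    using ij ij' nn A y(2) by (intro mult_pos_pos) (auto simp: nonneg_mat_def order.strict_iff_order)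
  also have "\<dots> \<le> (\<Sum>j<n. A $$ (i, j) * y $ j)"
    using ij' nn A y(2) by (intro member_le_sum) (auto simp: nonneg_mat_def)
  also have "\<dots> = (A *\<^sub>v y) $ i" by (rule mult_mat_vec_sum[OF A y(1) ij'(1), symmetric])
  finally show ?thesis using ij by auto
qed

lemma nonneg_eigenvector_positive:
  fixes A :: "real mat"
  assumes A: "A \<in> carrier_mat n n" and nn: "nonneg_mat A" and sc: "strongly_connected_mat n A"
    and y: "y \<in> carrier_vec n" "\<forall>i<n. 0 \<le> y $ i" "y \<noteq> 0\<^sub>v n"
    and ev: "A *\<^sub>v y = r \<cdot>\<^sub>v y"
  shows "\<forall>i<n. 0 < y $ i"
proof (rule ccontr)
  assume "\<not> ?thesis"
  then obtain i where "i < n" "\<not> 0 < y $ i" by blast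
  moreover from this have "0 \<le> y $ i" using y(2) by simp
  ultimately have "\<exists>i<n. y $ i = 0" by (intro exI[of _ i]) simp
  from strongly_connected_support_grows[OF A nn sc y this]
  show False using ev y by auto
qed

text \<open>The summand \<open>1\<close> keeps the support from losing elements, while \<open>A\<close> adds at least one
  element to every proper support. So \<open>m\<close> steps suffice if \<open>y\<close> has at most \<open>m\<close> zero coordinates.\<close>

lemma one_plus_mat_pow_positive:
  fixes A :: "real mat"
  assumes A: "A \<in> carrier_mat n n" and nn: "nonneg_mat A" and sc: "strongly_connected_mat n A"
    and "y \<in> carrier_vec n" "\<forall>i<n. 0 \<le> y $ i" "y \<noteq> 0\<^sub>v n" "card {i. i < n \<and> y $ i = 0} \<le> m"
  shows "\<forall>i<n. 0 < ((1\<^sub>m n + A) ^\<^sub>m m *\<^sub>v y) $ i"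
  using assms(4-)
proof (induction m arbitrary: y)
  case 0
  then have "{i. i < n \<and> y $ i = 0} = {}" by simp
  then have "y $ i \<noteq> 0" if "i < n" for i using that by blast
  then have "\<forall>i<n. 0 < y $ i" using 0(2) by (simp add: order.strict_iff_order)
  moreover have "(1\<^sub>m n + A) ^\<^sub>m 0 *\<^sub>v y = y" using A 0(1) by simp
  ultimately show ?case by (simp only: simp_thms)
next
  case (Suc m)
  let ?Q = "1\<^sub>m n + A"
  define a where "a = A *\<^sub>v y"
  define y' where "y' = ?Q *\<^sub>v y"
  have Q: "?Q \<in> carrier_mat n n" using A by simp
  have "y' = 1\<^sub>m n *\<^sub>v y + a"
    unfolding y'_def a_def by (rule add_mult_distrib_mat_vec[OF one_carrier_mat A Suc.prems(1)])
  then have y'_eq: "y' = y + a" using Suc.prems(1) by simp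
  have a: "a \<in> carrier_vec n" using A Suc.prems(1) by (simp add: a_def)
  have y'_i: "y' $ i = y $ i + a $ i" if "i < n" for i
    unfolding y'_eq using a that by simp
  have a_nn: "0 \<le> a $ i" if "i < n" for i
    unfolding a_def by (rule mult_mat_vec_nonneg[OF A nn Suc.prems(1,2) that])
  have y'c: "y' \<in> carrier_vec n" using a Suc.prems(1) by (simp add: y'_eq)
  have nn': "\<forall>i<n. 0 \<le> y' $ i" using y'_i a_nn Suc.prems(2) by simp
  have zero: "y $ i = 0 \<and> a $ i = 0" if "i < n" "y' $ i = 0" for i
    using y'_i[OF that(1)] a_nn[OF that(1)] Suc.prems(2) that by (simp add: add_nonneg_eq_0_iff)
  have nz: "y' \<noteq> 0\<^sub>v n"
  proof
    assume eq: "y' = 0\<^sub>v n"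
    have "y = 0\<^sub>v n"
    proof (rule eq_vecI)
      fix i assume i: "i < dim_vec (0\<^sub>v n :: real vec)"
      then have "y' $ i = 0" unfolding eq by simp
      then show "y $ i = 0\<^sub>v n $ i" using zero[of i] i by simp
    qed (use Suc.prems(1) in simp)
    then show False using Suc.prems(3) by simp
  qed
  have card: "card {i. i < n \<and> y' $ i = 0} \<le> m"
  proof (cases "\<exists>i<n. y $ i = 0")
    case True
    obtain i where "i < n" "y $ i = 0" "0 < a $ i"
      using strongly_connected_support_grows[OF A nn sc Suc.prems(1-3) True] unfolding a_def by blast
    then have "i \<in> {i. i < n \<and> y $ i = 0}" "i \<notin> {i. i < n \<and> y' $ i = 0}"
      using zero[of i] by auto
    moreover have "{i. i < n \<and> y' $ i = 0} \<subseteq> {i. i < n \<and> y $ i = 0}" using zero by blast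
    ultimately have "{i. i < n \<and> y' $ i = 0} \<subset> {i. i < n \<and> y $ i = 0}" by blast
    then have "card {i. i < n \<and> y' $ i = 0} < card {i. i < n \<and> y $ i = 0}"
      by (intro psubset_card_mono) simp_all
    then show ?thesis using Suc.prems(4) by linarith
  next
    case False
    then have "{i. i < n \<and> y' $ i = 0} = {}" using zero by blast
    then show ?thesis by (simp only: card.empty le0)
  qed
  have "?Q ^\<^sub>m Suc m *\<^sub>v y = ?Q ^\<^sub>m m *\<^sub>v y'"
    unfolding y'_def pow_mat.simps(2)
    by (rule assoc_mult_mat_vec[OF pow_carrier_mat[OF Q] Q Suc.prems(1)])
  then show ?case using Suc.IH[OF y'c nn' nz card] by (simp only:)
qed

section \<open>Lower bounds on the spectral radius\<close>

lemma pow_mat_commute: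
  fixes A :: "'a :: semiring_1 mat"
  assumes A: "A \<in> carrier_mat n n" and B: "B \<in> carrier_mat n n" and AB: "A * B = B * A"
  shows "A * B ^\<^sub>m k = B ^\<^sub>m k * A"
proof (induction k)
  case 0
  then show ?case using A B by simp
next
  case (Suc k)
  have Bk: "B ^\<^sub>m k \<in> carrier_mat n n" using B by simp
  have "A * B ^\<^sub>m Suc k = A * B ^\<^sub>m k * B" using A B Bk by (simp add: assoc_mult_mat[of _ n n _ n _ n])
  also have "\<dots> = B ^\<^sub>m k * (A * B)" unfolding Suc using A B Bk by (simp add: assoc_mult_mat[of _ n n _ n _ n])
  also have "\<dots> = B ^\<^sub>m Suc k * A" unfolding AB using A B Bk by (simp add: assoc_mult_mat[of _ n n _ n _ n])
  finally show ?case .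
qed

lemma spectral_radius_rescale_le:
  fixes A :: "complex mat"
  assumes A: "A \<in> carrier_mat n n" and n: "n > 0" and t: "t > 0"
  shows "t * spectral_radius (complex_of_real (1 / t) \<cdot>\<^sub>m A) \<le> spectral_radius A"
proof -
  let ?C = "complex_of_real (1 / t) \<cdot>\<^sub>m A"
  have C: "?C \<in> carrier_mat n n" using A by simp
  from spectral_radius_mem_max(1)[OF C n] obtain c
    where c: "eigenvalue ?C c" "spectral_radius ?C = norm c" by (auto simp: spectrum_def)
  from c obtain v where v: "v \<in> carrier_vec n" "v \<noteq> 0\<^sub>v n" "?C *\<^sub>v v = c \<cdot>\<^sub>v v"
    using A by (auto simp: eigenvalue_def eigenvector_def)
  have "A *\<^sub>v v = complex_of_real t \<cdot>\<^sub>v (?C *\<^sub>v v)"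
    using A v(1) t by (intro eq_vecI) auto
  then have "A *\<^sub>v v = (complex_of_real t * c) \<cdot>\<^sub>v v" using v by (simp add: smult_smult_assoc)
  then have "eigenvalue A (complex_of_real t * c)"
    using v A by (auto simp: eigenvalue_def eigenvector_def)
  then have "norm (complex_of_real t * c) \<le> spectral_radius A"
    by (intro spectral_radius_mem_max(2)[OF A n]) (auto simp: spectrum_def)
  then show ?thesis using c t by (simp add: norm_mult)
qed

text \<open>By induction \<open>A ^ k y \<ge> s ^ k y\<close>. If the spectral radius were below some \<open>t < s\<close>, then the
  powers of \<open>A / t\<close> would stay bounded, by the Jordan normal form, although they stretch
  \<open>y\<close> by at least \<open>(s / t) ^ k\<close>.\<close>

lemma spectral_radius_ge_of_subinvariant:
  fixes A :: "real mat"
  assumes A: "A \<in> carrier_mat n n" and nn: "nonneg_mat A"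
    and y: "y \<in> carrier_vec n" "\<forall>i<n. 0 \<le> y $ i" "y \<noteq> 0\<^sub>v n"
    and s: "0 < s" and le: "\<forall>i<n. s * y $ i \<le> (A *\<^sub>v y) $ i"
  shows "s \<le> real_spectral_radius A"
proof (rule ccontr)
  assume "\<not> ?thesis"
  then have less: "real_spectral_radius A < s" by simp
  have n: "n > 0" using y by (cases n) auto
  let ?AC = "map_mat complex_of_real A"
  have AC: "?AC \<in> carrier_mat n n" using A by simp
  have "0 \<le> real_spectral_radius A"
    using spectral_radius_mem_max(1)[OF AC n] by (auto simp: real_spectral_radius_def)
  \<comment> \<open>Powers of a matrix are uniformly bounded if its spectral radius is below 1. The
    midpoint leaves room on both sides: \<open>A / t\<close> has spectral radius below 1, and \<open>s / t > 1\<close>.\<close>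
  define t where "t = (real_spectral_radius A + s) / 2"
  have t: "0 < t" "real_spectral_radius A < t" "t < s"
    using less s \<open>0 \<le> real_spectral_radius A\<close> by (auto simp: t_def)
  define C where "C = (1 / t) \<cdot>\<^sub>m A"
  have C: "C \<in> carrier_mat n n" using A by (simp add: C_def)
  have mC: "map_mat complex_of_real C = complex_of_real (1 / t) \<cdot>\<^sub>m ?AC"
    using A by (intro eq_matI) (auto simp: C_def)
  have "t * spectral_radius (map_mat complex_of_real C) \<le> real_spectral_radius A"
    unfolding mC real_spectral_radius_def by (rule spectral_radius_rescale_le[OF AC n t(1)])
  also have "\<dots> < t * 1" using t(2) by simp
  finally have "spectral_radius (map_mat complex_of_real C) < 1"
    using t(1) by (simp only: mult_less_cancel_left_pos)
  then obtain c where c: "\<And>k. norm_bound (map_mat complex_of_real C ^\<^sub>m k) c"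
    using spectral_radius_jnf_norm_bound_less_1_upper_triangular[of "map_mat complex_of_real C" n] C
    by auto
  have bound: "\<bar>(C ^\<^sub>m k) $$ (i, j)\<bar> \<le> c" if "i < n" "j < n" for k i j
  proof -
    have "map_mat complex_of_real C ^\<^sub>m k = map_mat complex_of_real (C ^\<^sub>m k)"
      using of_real_hom.mat_hom_pow[OF C] by metis
    then show ?thesis using c[of k] that C by (auto simp: norm_bound_def)
  qed
  have Cnn: "nonneg_mat C" using nn A t by (auto simp: nonneg_mat_def C_def)
  define q where "q = s / t"
  have q: "1 < q" using t by (simp add: q_def)
  have Cy: "q * y $ i \<le> (C *\<^sub>v y) $ i" if "i < n" for i
    using le that A y(1) t(1) by (auto simp: C_def q_def divide_right_mono)
  have pow: "q ^ k * y $ i \<le> (C ^\<^sub>m k *\<^sub>v y) $ i" if "i < n" for k i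
    using that
  proof (induction k arbitrary: i)
    case 0
    then show ?case using C y by simp
  next
    case (Suc k)
    have Ck: "C ^\<^sub>m k \<in> carrier_mat n n" using C by simp
    have comm: "C ^\<^sub>m Suc k = C * C ^\<^sub>m k"
      using pow_mat_commute[OF C C refl] by simp
    have "q ^ Suc k * y $ i \<le> q ^ k * (C *\<^sub>v y) $ i"
      using Cy[OF Suc.prems] q by (simp add: mult.assoc mult.left_commute)
    also have "\<dots> = (\<Sum>j<n. C $$ (i, j) * (q ^ k * y $ j))"
      unfolding mult_mat_vec_sum[OF C y(1) Suc.prems] by (simp add: sum_distrib_left mult_ac)
    also have "\<dots> \<le> (\<Sum>j<n. C $$ (i, j) * (C ^\<^sub>m k *\<^sub>v y) $ j)"
      using Suc Cnn C by (intro sum_mono mult_left_mono) (auto simp: nonneg_mat_def)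
    also have "\<dots> = (C *\<^sub>v (C ^\<^sub>m k *\<^sub>v y)) $ i"
      by (rule mult_mat_vec_sum[OF C mult_mat_vec_carrier[OF Ck y(1)] Suc.prems, symmetric])
    also have "C *\<^sub>v (C ^\<^sub>m k *\<^sub>v y) = C ^\<^sub>m Suc k *\<^sub>v y"
      unfolding comm using C Ck y by (simp add: assoc_mult_mat_vec[of _ n n _ n])
    finally show ?case .
  qed
  obtain i where i: "i < n" "0 < y $ i"
    using y by (metis eq_vecI carrier_vecD index_zero_vec order.not_eq_order_implies_strict)
  define K where "K = (\<Sum>j<n. c * y $ j)"
  have up: "q ^ k * y $ i \<le> K" for k
  proof -
    have "q ^ k * y $ i \<le> (C ^\<^sub>m k *\<^sub>v y) $ i" by (rule pow[OF i(1)])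
    also have "\<dots> = (\<Sum>j<n. (C ^\<^sub>m k) $$ (i, j) * y $ j)" using C y i by (intro mult_mat_vec_sum) auto
    also have "\<dots> \<le> K" unfolding K_def
      using bound[OF i(1)] y(2) by (intro sum_mono mult_right_mono) (auto simp: abs_le_iff)
    finally show ?thesis .
  qed
  obtain k where "K / y $ i < q ^ k" using real_arch_pow[OF q] by blast
  then show False using up[of k] i by (simp add: field_simps)
qed

section \<open>Perron vectors\<close>

text \<open>If \<open>A y\<close> differed from \<open>r y\<close>, then \<open>z = A y - r y\<close> would be nonnegative and nonzero, so
  \<open>B = (1 + A) ^ n\<close> would make it positive. As \<open>B\<close> commutes with \<open>A\<close>, the positive vector \<open>x = B y\<close> satisfies
  \<open>A x - r x = B z > 0\<close>, which leaves room for a factor \<open>r + e\<close> in place of \<open>r\<close>,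
  contradicting that \<open>r\<close> bounds the spectral radius.\<close>

lemma subinvariant_vec_invariant:
  fixes A :: "real mat"
  assumes A: "A \<in> carrier_mat n n" and nn: "nonneg_mat A" and sc: "strongly_connected_mat n A"
    and y: "y \<in> carrier_vec n" "\<forall>i<n. 0 \<le> y $ i" "y \<noteq> 0\<^sub>v n"
    and r: "0 \<le> r" "real_spectral_radius A \<le> r" and le: "\<forall>i<n. r * y $ i \<le> (A *\<^sub>v y) $ i"
  shows "A *\<^sub>v y = r \<cdot>\<^sub>v y"
proof (rule ccontr)
  assume neq: "A *\<^sub>v y \<noteq> r \<cdot>\<^sub>v y"
  have n: "n > 0" using y by (cases n) auto
  let ?Q = "1\<^sub>m n + A"
  have Q: "?Q \<in> carrier_mat n n" using A by simp
  define B where "B = ?Q ^\<^sub>m n"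
  have B: "B \<in> carrier_mat n n" using Q by (simp add: B_def)
  have "A * ?Q = A * 1\<^sub>m n + A * A" by (rule mult_add_distrib_mat[OF A one_carrier_mat A])
  also have "\<dots> = 1\<^sub>m n * A + A * A" using A by simp
  also have "\<dots> = ?Q * A" by (rule add_mult_distrib_mat[OF one_carrier_mat A A, symmetric])
  finally have "A * ?Q = ?Q * A" .
  then have AB: "A * B = B * A" unfolding B_def by (rule pow_mat_commute[OF A Q])
  have pos: "\<forall>i<n. 0 < (B *\<^sub>v x) $ i"
    if "x \<in> carrier_vec n" "\<forall>i<n. 0 \<le> x $ i" "x \<noteq> 0\<^sub>v n" for x
    unfolding B_def by (rule one_plus_mat_pow_positive[OF A nn sc that])
      (rule order.trans[OF card_mono[of "{..<n}"]]; auto)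
  define z where "z = A *\<^sub>v y - r \<cdot>\<^sub>v y"
  have z: "z \<in> carrier_vec n" using A y by (simp add: z_def)
  have zi: "z $ i = (A *\<^sub>v y) $ i - r * y $ i" if "i < n" for i
    using A y that by (simp add: z_def)
  have "\<forall>i<n. 0 \<le> z $ i" using le zi by simp
  moreover have "z \<noteq> 0\<^sub>v n"
  proof
    assume "z = 0\<^sub>v n"
    then have "(A *\<^sub>v y) $ i = r * y $ i" if "i < n" for i using zi[OF that] that by simp
    then have "A *\<^sub>v y = r \<cdot>\<^sub>v y" using A y by (intro eq_vecI) auto
    then show False using neq by simp
  qed
  ultimately have Bz: "\<forall>i<n. 0 < (B *\<^sub>v z) $ i" using pos z by blast
  define x where "x = B *\<^sub>v y"
  have x: "x \<in> carrier_vec n" "\<forall>i<n. 0 < x $ i" using pos[OF y] B y by (auto simp: x_def)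
  have "B *\<^sub>v z = B *\<^sub>v (A *\<^sub>v y) - B *\<^sub>v (r \<cdot>\<^sub>v y)"
    unfolding z_def using A B y by (simp add: mult_minus_distrib_mat_vec[of _ n n])
  also have "B *\<^sub>v (A *\<^sub>v y) = A *\<^sub>v x"
    using A B y AB unfolding x_def by (metis assoc_mult_mat_vec)
  also have "B *\<^sub>v (r \<cdot>\<^sub>v y) = r \<cdot>\<^sub>v x" using B y unfolding x_def by (simp add: mult_mat_vec)
  finally have Bz_eq: "B *\<^sub>v z = A *\<^sub>v x - r \<cdot>\<^sub>v x" .
  \<comment> \<open>The largest factor that all \<open>n\<close> coordinates allow.\<close>
  define e where "e = Min ((\<lambda>i. (B *\<^sub>v z) $ i / x $ i) ` {..<n})"
  have "e \<in> (\<lambda>i. (B *\<^sub>v z) $ i / x $ i) ` {..<n}"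
    unfolding e_def using n by (intro Min_in) auto
  then have e: "0 < e" using Bz x by auto
  have "(r + e) * x $ i \<le> (A *\<^sub>v x) $ i" if "i < n" for i
  proof -
    have "e \<le> (B *\<^sub>v z) $ i / x $ i" unfolding e_def using that by (intro Min_le) auto
    then have "e * x $ i \<le> (B *\<^sub>v z) $ i" using x that by (simp add: field_simps)
    also have "\<dots> = (A *\<^sub>v x) $ i - r * x $ i" unfolding Bz_eq using A x that by simp
    finally show ?thesis by (simp add: algebra_simps)
  qed
  then have "r + e \<le> real_spectral_radius A"
    using x r e n by (intro spectral_radius_ge_of_subinvariant[OF A nn x(1)]) (auto intro: less_imp_le)
  then show False using e r by simp
qed

text \<open>For an eigenvector \<open>z\<close> whose eigenvalue has modulus \<open>r\<close>, the triangle inequality gives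
  \<open>r \<bar>z\<bar> \<le> A \<bar>z\<bar>\<close> entrywise.\<close>

lemma perron_vector_exists:
  fixes A :: "real mat"
  assumes A: "A \<in> carrier_mat n n" and nn: "nonneg_mat A" and sc: "strongly_connected_mat n A"
    and n: "n > 0"
  obtains v where "v \<in> carrier_vec n" "\<forall>i<n. 0 < v $ i" "A *\<^sub>v v = real_spectral_radius A \<cdot>\<^sub>v v"
proof -
  let ?AC = "map_mat complex_of_real A"
  define r where "r = real_spectral_radius A"
  have AC: "?AC \<in> carrier_mat n n" using A by simp
  from spectral_radius_mem_max(1)[OF AC n] obtain c
    where c: "eigenvalue ?AC c" "r = norm c"
    by (auto simp: spectrum_def real_spectral_radius_def r_def)
  then obtain z where z: "z \<in> carrier_vec n" "z \<noteq> 0\<^sub>v n" "?AC *\<^sub>v z = c \<cdot>\<^sub>v z"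
    using A by (auto simp: eigenvalue_def eigenvector_def)
  define y where "y = map_vec norm z"
  have y: "y \<in> carrier_vec n" "\<forall>i<n. 0 \<le> y $ i" using z by (auto simp: y_def)
  have "y \<noteq> 0\<^sub>v n"
  proof
    assume eq: "y = 0\<^sub>v n"
    have "z $ i = 0" if "i < n" for i
      using arg_cong[OF eq, of "\<lambda>v. v $ i"] that z(1) by (simp add: y_def)
    then show False using z by (auto intro!: eq_vecI)
  qed
  note y = y this
  have "r * y $ i \<le> (A *\<^sub>v y) $ i" if i: "i < n" for i
  proof -
    have "r * y $ i = norm ((c \<cdot>\<^sub>v z) $ i)" using z i c by (simp add: y_def norm_mult)
    also have "\<dots> = norm (\<Sum>j<n. ?AC $$ (i, j) * z $ j)"
      unfolding z(3)[symmetric] using AC z i by (subst mult_mat_vec_sum) auto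
    also have "\<dots> \<le> (\<Sum>j<n. norm (?AC $$ (i, j) * z $ j))" by (rule norm_sum)
    also have "\<dots> = (\<Sum>j<n. A $$ (i, j) * y $ j)"
      using A z i nn by (intro sum.cong) (auto simp: norm_mult y_def nonneg_mat_def)
    also have "\<dots> = (A *\<^sub>v y) $ i" by (rule mult_mat_vec_sum[OF A y(1) i, symmetric])
    finally show ?thesis .
  qed
  moreover have "0 \<le> r" "real_spectral_radius A \<le> r" using c(2) by (simp, simp add: r_def)
  ultimately have Ay: "A *\<^sub>v y = r \<cdot>\<^sub>v y"
    by (intro subinvariant_vec_invariant[OF A nn sc y]) simp_all
  show thesis
    by (rule that[OF y(1) nonneg_eigenvector_positive[OF A nn sc y Ay] Ay[unfolded r_def]])
qed

text \<open>Subtract from \<open>x\<close> the largest multiple of \<open>v\<close> that leaves a nonnegative vector. The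
  difference has a zero coordinate, and a nonzero nonnegative eigenvector has none.\<close>

lemma eigenspace_of_positive_vector:
  fixes A :: "real mat"
  assumes A: "A \<in> carrier_mat n n" and nn: "nonneg_mat A" and sc: "strongly_connected_mat n A"
    and n: "n > 0"
    and v: "v \<in> carrier_vec n" "\<forall>i<n. 0 < v $ i" "A *\<^sub>v v = r \<cdot>\<^sub>v v"
    and x: "x \<in> carrier_vec n" "A *\<^sub>v x = r \<cdot>\<^sub>v x"
  shows "\<exists>t. x = t \<cdot>\<^sub>v v"
proof -
  define t where "t = Min ((\<lambda>i. x $ i / v $ i) ` {..<n})"
  have "t \<in> (\<lambda>i. x $ i / v $ i) ` {..<n}" unfolding t_def using n by (intro Min_in) auto
  then obtain k where k: "k < n" "t = x $ k / v $ k" by auto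
  have t: "t * v $ i \<le> x $ i" if "i < n" for i
  proof -
    have "t \<le> x $ i / v $ i" unfolding t_def using that by (intro Min_le) auto
    then show ?thesis using v that by (simp add: field_simps)
  qed
  define y where "y = x - t \<cdot>\<^sub>v v"
  have y: "y \<in> carrier_vec n" "\<forall>i<n. 0 \<le> y $ i" using x v t by (auto simp: y_def)
  have "A *\<^sub>v y = A *\<^sub>v x - t \<cdot>\<^sub>v (A *\<^sub>v v)"
    unfolding y_def using A x v by (simp add: mult_minus_distrib_mat_vec[of _ n n] mult_mat_vec)
  also have "\<dots> = r \<cdot>\<^sub>v y" unfolding x(2) v(3) y_def using x v by (intro eq_vecI) (auto simp: algebra_simps)
  finally have Ay: "A *\<^sub>v y = r \<cdot>\<^sub>v y" .
  have "v $ k \<noteq> 0" using v(2) k(1) by (metis less_irrefl)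
  then have "y $ k = 0" using k x(1) v(1) by (simp add: y_def)
  then have "y = 0\<^sub>v n" using nonneg_eigenvector_positive[OF A nn sc y _ Ay] k by force
  have "x $ i = t * v $ i" if "i < n" for i
    using arg_cong[OF \<open>y = 0\<^sub>v n\<close>, of "\<lambda>u. u $ i"] that x v by (simp add: y_def)
  then have "x = t \<cdot>\<^sub>v v" using x v by (intro eq_vecI) auto
  then show ?thesis ..
qed

section \<open>Simple roots of the characteristic polynomial\<close>

text \<open>Cramer's rule exhibits a linear factor. Let \<open>M\<close> be \<open>X I - T\<close> with its first column
  replaced by \<open>v\<close>. As \<open>(X I - T) v = (X - \<mu>) v\<close>, Cramer's rule reads
  \<open>v\<^sub>0 \<chi> = (X - \<mu>) det M\<close> for the characteristic polynomial \<open>\<chi>\<close>. A further root \<open>\<mu>\<close> of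
  \<open>det M\<close> would give a nonzero kernel vector \<open>x\<close> of \<open>M\<close> at \<open>\<mu>\<close>, that is
  \<open>T u - \<mu> u = x\<^sub>0 v\<close>, where \<open>u\<close> is \<open>x\<close> with its first coordinate set to 0. Pairing with the left
  eigenvector \<open>w\<close> forces \<open>x\<^sub>0 = 0\<close>. Then \<open>u\<close> is a multiple of \<open>v\<close>, and it vanishes because its
  first coordinate does while \<open>v\<^sub>0\<close> does not; so \<open>x\<close> would be zero.\<close>

lemma order_char_poly_eq_1:
  fixes T :: "'a :: field mat"
  assumes T: "T \<in> carrier_mat n n" and n: "n > 0"
    and v: "v \<in> carrier_vec n" "v $ 0 \<noteq> 0" "T *\<^sub>v v = \<mu> \<cdot>\<^sub>v v"
    and w: "w \<in> carrier_vec n" "transpose_mat T *\<^sub>v w = \<mu> \<cdot>\<^sub>v w" "w \<bullet> v \<noteq> 0"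
    and ker: "\<And>x. x \<in> carrier_vec n \<Longrightarrow> T *\<^sub>v x = \<mu> \<cdot>\<^sub>v x \<Longrightarrow> \<exists>t. x = t \<cdot>\<^sub>v v"
  shows "Polynomial.order \<mu> (char_poly T) = 1"
proof -
  let ?X = "char_poly_matrix T"
  have X: "?X \<in> carrier_mat n n" using T by simp
  let ?v = "map_vec (\<lambda>a. [:a:]) v"
  have v': "?v \<in> carrier_vec n" using v by simp
  have const_sum: "(\<Sum>j<n. [:f j:]) = [:\<Sum>j<n. f j:]" for f :: "nat \<Rightarrow> 'a"
    by (simp add: poly_eq_iff coeff_sum coeff_pCons split: nat.split)
  have Xv: "(?X *\<^sub>v ?v) $ i = [:-\<mu>, 1:] * [:v $ i:]" if i: "i < n" for i
  proof -
    have "(?X *\<^sub>v ?v) $ i = (\<Sum>j<n. ?X $$ (i, j) * ?v $ j)" by (rule mult_mat_vec_sum[OF X v' i])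
    also have "\<dots> = (\<Sum>j<n. (if i = j then [:0, v $ j:] else 0) - [:T $$ (i, j) * v $ j:])"
      using T v i by (intro sum.cong) (auto simp: char_poly_matrix_def)
    also have "\<dots> = [:0, v $ i:] - [:\<Sum>j<n. T $$ (i, j) * v $ j:]"
      using i by (simp add: sum_subtractf const_sum)
    also have "(\<Sum>j<n. T $$ (i, j) * v $ j) = (T *\<^sub>v v) $ i"
      by (rule mult_mat_vec_sum[OF T v(1) i, symmetric])
    also have "\<dots> = \<mu> * v $ i" using v(1) i unfolding v(3) by simp
    finally show ?thesis by simp
  qed
  define M where "M = replace_col ?X ?v 0"
  have M: "M \<in> carrier_mat n n" using X unfolding M_def replace_col_def by auto
  have "replace_col ?X (?X *\<^sub>v ?v) 0 = multcol 0 [:-\<mu>, 1:] M"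
  proof (rule eq_matI)
    fix i j assume "i < dim_row (multcol 0 [:-\<mu>, 1:] M)" "j < dim_col (multcol 0 [:-\<mu>, 1:] M)"
    then have ij: "i < n" "j < n" using M by simp_all
    have "replace_col ?X (?X *\<^sub>v ?v) 0 $$ (i, j)
        = (if j = 0 then [:-\<mu>, 1:] * [:v $ i:] else ?X $$ (i, j))"
      using ij X Xv[OF ij(1)] by (simp only: replace_col_def carrier_matD index_mat(1) case_prod_conv)
    also have "\<dots> = multcol 0 [:-\<mu>, 1:] M $$ (i, j)"
      using ij M X v(1) by (simp add: M_def replace_col_def mat_multcol_def)
    finally show "replace_col ?X (?X *\<^sub>v ?v) 0 $$ (i, j) = multcol 0 [:-\<mu>, 1:] M $$ (i, j)" .
  qed (use X M in \<open>simp_all add: replace_col_def\<close>)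
  also have "\<dots> = M * multrow_mat n 0 [:-\<mu>, 1:]" by (rule multcol_mat[OF M])
  finally have "det (replace_col ?X (?X *\<^sub>v ?v) 0) = det M * [:-\<mu>, 1:]"
    using det_mult[OF M, of "multrow_mat n 0 [:-\<mu>, 1:]"] n by (simp add: det_multrow_mat)
  then have eq: "Polynomial.smult (v $ 0) (char_poly T) = [:-\<mu>, 1:] * det M"
    using cramer_lemma_mat[OF X v' n] v n by (simp add: char_poly_def mult.commute)
  have "poly (det M) \<mu> \<noteq> 0"
  proof
    assume 0: "poly (det M) \<mu> = 0"
    \<comment> \<open>\<open>M\<close> evaluated at \<open>\<mu>\<close>.\<close>
    define N where "N = mat n n (\<lambda>(i, j). if j = 0 then v $ i else (if i = j then \<mu> else 0) - T $$ (i, j))"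
    have N: "N \<in> carrier_mat n n" by (simp add: N_def)
    have "poly (det M) \<mu> = det N"
      using T v by (intro poly_det_cong[OF N M])
        (auto simp: M_def N_def replace_col_def char_poly_matrix_def)
    then obtain x where x: "x \<in> carrier_vec n" "x \<noteq> 0\<^sub>v n" "N *\<^sub>v x = 0\<^sub>v n"
      using 0 det_0_iff_vec_prod_zero[OF N] by auto
    define u where "u = vec n (\<lambda>i. if i = 0 then 0 else x $ i)"
    have u: "u \<in> carrier_vec n" by (simp add: u_def)
    have Tu: "(T *\<^sub>v u) $ i = \<mu> * u $ i + x $ 0 * v $ i" if i: "i < n" for i
    proof -
      have "0 = (\<Sum>j<n. N $$ (i, j) * x $ j)"
        using mult_mat_vec_sum[OF N x(1) i] x(3) i by simp
      also have "\<dots> = (\<Sum>j<n. (if j = 0 then v $ i * x $ 0 else 0) + (if j = i then \<mu> * u $ i else 0)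
          - T $$ (i, j) * u $ j)"
        using i by (intro sum.cong) (auto simp: N_def u_def algebra_simps)
      also have "\<dots> = v $ i * x $ 0 + \<mu> * u $ i - (\<Sum>j<n. T $$ (i, j) * u $ j)"
        using i n by (simp add: sum_subtractf sum.distrib)
      also have "(\<Sum>j<n. T $$ (i, j) * u $ j) = (T *\<^sub>v u) $ i"
        by (rule mult_mat_vec_sum[OF T u i, symmetric])
      finally show ?thesis by (simp add: algebra_simps)
    qed
    have Tu': "T *\<^sub>v u = \<mu> \<cdot>\<^sub>v u + x $ 0 \<cdot>\<^sub>v v" using T u v Tu by (intro eq_vecI) auto
    have "w \<bullet> (T *\<^sub>v u) = (transpose_mat T *\<^sub>v w) \<bullet> u"
      using transpose_vec_mult_scalar[OF T u w(1)] by simp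
    then have "\<mu> * (w \<bullet> u) + x $ 0 * (w \<bullet> v) = \<mu> * (w \<bullet> u)"
      unfolding Tu' w(2) using w u v by (simp add: scalar_prod_add_distrib[of _ n])
    then have x0: "x $ 0 = 0" using w(3) by simp
    then have "T *\<^sub>v u = \<mu> \<cdot>\<^sub>v u" unfolding Tu' using u v by (intro eq_vecI) auto
    then obtain t where t: "u = t \<cdot>\<^sub>v v" using ker u by blast
    have "t * v $ 0 = 0" using arg_cong[OF t, of "\<lambda>y. y $ 0"] n v by (simp add: u_def)
    then have "u = 0\<^sub>v n" using t v by auto
    have "x $ i = 0" if "i < n" for i
    proof (cases "i = 0")
      case False
      have "u $ i = 0" using \<open>u = 0\<^sub>v n\<close> that by simp
      then show ?thesis using False that by (simp add: u_def)
    qed (simp add: x0)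
    then show False using x by (auto intro!: eq_vecI)
  qed
  then have M0: "Polynomial.order \<mu> (det M) = 0" "det M \<noteq> 0" by (auto simp: order_0I)
  have "Polynomial.order \<mu> [:-\<mu>, 1:] = 1" using order_power_n_n[of \<mu> 1] by simp
  moreover have nz: "[:-\<mu>, 1:] * det M \<noteq> 0" using M0(2) by (simp only: mult_eq_0_iff) simp
  ultimately have "Polynomial.order \<mu> ([:-\<mu>, 1:] * det M) = 1"
    using M0(1) unfolding order_mult[OF nz] by simp
  then show ?thesis unfolding eq[symmetric] using v by (simp add: order_smult)
qed

section \<open>Spectral radius of transposes and powers\<close>

lemma real_spectral_radius_transpose:
  assumes A: "A \<in> carrier_mat n n"
  shows "real_spectral_radius (transpose_mat A) = real_spectral_radius A"
proof -
  let ?h = "map_mat complex_of_real"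
  have "?h (transpose_mat A) = transpose_mat (?h A)" using A by (intro eq_matI) auto
  then have "spectrum (?h (transpose_mat A)) = spectrum (?h A)"
    using A spectrum_root_char_poly[of "?h A" n] spectrum_root_char_poly[of "transpose_mat (?h A)" n]
      char_poly_transpose_mat[of "?h A" n] by simp
  then show ?thesis by (simp add: real_spectral_radius_def spectral_radius_def)
qed

lemma spectral_radius_pow_ge:
  assumes A: "A \<in> carrier_mat n n" and n: "n > 0"
  shows "spectral_radius A ^ k \<le> spectral_radius (A ^\<^sub>m k)"
proof -
  from spectral_radius_mem_max(1)[OF A n] obtain c
    where c: "eigenvalue A c" "spectral_radius A = norm c" by (auto simp: spectrum_def)
  then obtain v where v: "eigenvector A v c" by (auto simp: eigenvalue_def)
  have "eigenvalue (A ^\<^sub>m k) (c ^ k)"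
    using eigenvector_pow[OF A v, of k] v A by (auto simp: eigenvalue_def eigenvector_def)
  then have "norm (c ^ k) \<le> spectral_radius (A ^\<^sub>m k)"
    using A n by (intro spectral_radius_mem_max(2)[of _ n]) (auto simp: spectrum_def)
  then show ?thesis using c by (simp add: norm_power)
qed

section \<open>Roots of irreducible nonnegative matrices\<close>

text \<open>A matrix that commutes with \<open>A\<close> maps each eigenspace of \<open>A\<close> to itself, and the one that
  contains \<open>v\<close> is a line.\<close>

lemma commuting_mat_shares_eigenvector:
  fixes A T :: "real mat"
  assumes A: "A \<in> carrier_mat n n" and nn: "nonneg_mat A" and sc: "strongly_connected_mat n A"
    and n: "n > 0" and T: "T \<in> carrier_mat n n" "A * T = T * A"
    and v: "v \<in> carrier_vec n" "\<forall>i<n. 0 < v $ i" "A *\<^sub>v v = r \<cdot>\<^sub>v v"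
  shows "\<exists>\<mu>. T *\<^sub>v v = \<mu> \<cdot>\<^sub>v v"
proof (rule eigenspace_of_positive_vector[OF A nn sc n v])
  show "T *\<^sub>v v \<in> carrier_vec n" using T v by simp
  have "A *\<^sub>v (T *\<^sub>v v) = T *\<^sub>v (A *\<^sub>v v)" using A T v by (metis assoc_mult_mat_vec)
  then show "A *\<^sub>v (T *\<^sub>v v) = r \<cdot>\<^sub>v (T *\<^sub>v v)" using T v by (simp add: mult_mat_vec)
qed

theorem theorem3p2:
  fixes T :: "real mat" and n :: nat
  assumes "n > 0"
    and "T \<in> carrier_mat n n"
    and "\<forall>j<n. (\<Sum>i<n. T $$ (i, j)) > 0"
    and "\<exists>k::nat. k > 0 \<and> irreducible_mat (T ^\<^sub>m k) \<and> nonneg_mat (T ^\<^sub>m k)"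
  shows "eigenvalue T (real_spectral_radius T) \<and>
    Polynomial.order (real_spectral_radius T) (char_poly T) = 1"
proof -
  note n = assms(1) and T = assms(2) and colsum = assms(3)
  obtain k where k: "k > 0" "irreducible_mat (T ^\<^sub>m k)" "nonneg_mat (T ^\<^sub>m k)"
    using assms(4) by blast
  define A where "A = T ^\<^sub>m k"
  define r where "r = real_spectral_radius A"
  have A: "A \<in> carrier_mat n n" using T by (simp add: A_def)
  have nn: "nonneg_mat A" using k by (simp add: A_def)
  have sc: "strongly_connected_mat n A"
    using irreducible_imp_strongly_connected[OF A] k by (simp add: A_def)
  have AT: "A * T = T * A" unfolding A_def using pow_mat_commute[OF T T refl] by simp
  let ?A' = "transpose_mat A" and ?T' = "transpose_mat T"
  have A': "?A' \<in> carrier_mat n n" and T': "?T' \<in> carrier_mat n n" using A T by auto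
  have nn': "nonneg_mat ?A'" using nn by (auto simp: nonneg_mat_def)
  have sc': "strongly_connected_mat n ?A'" by (rule strongly_connected_transpose[OF A sc])
  have AT': "?A' * ?T' = ?T' * ?A'" using AT A T by (metis transpose_mult)
  obtain v where v: "v \<in> carrier_vec n" "\<forall>i<n. 0 < v $ i" "A *\<^sub>v v = r \<cdot>\<^sub>v v"
    using perron_vector_exists[OF A nn sc n] unfolding r_def by blast
  obtain w where w: "w \<in> carrier_vec n" "\<forall>i<n. 0 < w $ i" "?A' *\<^sub>v w = r \<cdot>\<^sub>v w"
    using perron_vector_exists[OF A' nn' sc' n]
    unfolding r_def real_spectral_radius_transpose[OF A] by blast
  obtain \<mu> where Tv: "T *\<^sub>v v = \<mu> \<cdot>\<^sub>v v"
    using commuting_mat_shares_eigenvector[OF A nn sc n T AT v] by blast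
  obtain \<mu>' where Tw: "?T' *\<^sub>v w = \<mu>' \<cdot>\<^sub>v w"
    using commuting_mat_shares_eigenvector[OF A' nn' sc' n T' AT' w] by blast
  have wv: "0 < w \<bullet> v" using n v w by (auto simp: scalar_prod_def intro!: sum_pos)
  have "w \<bullet> (T *\<^sub>v v) = (?T' *\<^sub>v w) \<bullet> v" using transpose_vec_mult_scalar[OF T v(1) w(1)] by simp
  then have "\<mu> * (w \<bullet> v) = \<mu>' * (w \<bullet> v)" unfolding Tv Tw using v w by simp
  then have "\<mu>' = \<mu>" using wv by simp
  then have Tw: "?T' *\<^sub>v w = \<mu> \<cdot>\<^sub>v w" using Tw by simp
  \<comment> \<open>The entries of \<open>T v = \<mu> v\<close>, added up, show that \<open>\<mu>\<close> is positive.\<close>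
  have "\<mu> * (\<Sum>i<n. v $ i) = (\<Sum>i<n. (T *\<^sub>v v) $ i)" unfolding Tv using v by (simp add: sum_distrib_left)
  also have "\<dots> = (\<Sum>i<n. \<Sum>j<n. T $$ (i, j) * v $ j)" 
    by (intro sum.cong refl mult_mat_vec_sum[OF T v(1)]) simp
  also have "\<dots> = (\<Sum>j<n. (\<Sum>i<n. T $$ (i, j)) * v $ j)"
    by (subst sum.swap) (simp add: sum_distrib_right)
  also have "\<dots> > 0"
  proof (rule sum_pos)
    fix j assume "j \<in> {..<n}"
    then show "0 < (\<Sum>i<n. T $$ (i, j)) * v $ j" using v(2) colsum by (simp add: mult_pos_pos)
  qed (use n in auto)
  finally have "0 < \<mu> * (\<Sum>i<n. v $ i)" .
  moreover have "0 < (\<Sum>i<n. v $ i)" using n v by (intro sum_pos) auto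
  ultimately have \<mu>: "0 < \<mu>" by (simp add: zero_less_mult_iff)
  have "v \<noteq> 0\<^sub>v n" using v n by auto
  then have evec: "eigenvector T v \<mu>" using v T Tv by (auto simp: eigenvector_def)
  have "A *\<^sub>v v = \<mu> ^ k \<cdot>\<^sub>v v" unfolding A_def by (rule eigenvector_pow[OF T evec])
  then have "r * v $ 0 = \<mu> ^ k * v $ 0" using v n by (metis carrier_vecD index_smult_vec(1))
  then have r: "r = \<mu> ^ k" using v n by force
  have "real_spectral_radius T ^ k \<le> \<mu> ^ k"
  proof -
    let ?TC = "map_mat complex_of_real T"
    have "map_mat complex_of_real A = ?TC ^\<^sub>m k"
      unfolding A_def by (rule of_real_hom.mat_hom_pow[OF T])
    then show ?thesis using spectral_radius_pow_ge[of ?TC n k] T n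
      unfolding r[symmetric] r_def real_spectral_radius_def by simp
  qed
  then have "real_spectral_radius T \<le> \<mu>"
    using power_strict_mono[of \<mu> "real_spectral_radius T" k] \<mu> k(1) by linarith
  moreover have "\<mu> \<le> real_spectral_radius T"
  proof -
    have "eigenvalue (map_mat complex_of_real T) (complex_of_real \<mu>)"
      using of_real_hom.eigenvalue_hom[OF T] evec by (auto simp: eigenvalue_def)
    then have "norm (complex_of_real \<mu>) \<le> real_spectral_radius T"
      unfolding real_spectral_radius_def
      using T n by (intro spectral_radius_mem_max(2)[of _ n] imageI) (auto simp: spectrum_def)
    then show ?thesis using \<mu> by simp
  qed
  ultimately have rho: "real_spectral_radius T = \<mu>" by simp
  have ker: "\<exists>t. x = t \<cdot>\<^sub>v v" if x: "x \<in> carrier_vec n" "T *\<^sub>v x = \<mu> \<cdot>\<^sub>v x" for x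
  proof (cases "x = 0\<^sub>v n")
    case True
    then have "x = 0 \<cdot>\<^sub>v v" using v by auto
    then show ?thesis ..
  next
    case False
    then have "eigenvector T x \<mu>" using x T by (auto simp: eigenvector_def)
    then have "A *\<^sub>v x = r \<cdot>\<^sub>v x" unfolding r A_def by (rule eigenvector_pow[OF T])
    then show ?thesis by (rule eigenspace_of_positive_vector[OF A nn sc n v x(1)])
  qed
  have "Polynomial.order \<mu> (char_poly T) = 1"
    using v(2) n wv by (intro order_char_poly_eq_1[OF T n v(1) _ Tv w(1) Tw _ ker]) auto
  then show ?thesis using evec unfolding rho eigenvalue_def by blast
qed

end
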